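(* Let $\mathbb{G}=(\mathbb{V},\mathbb{E})$ be a connected acyclic undirected graph and let $\mathrm{T}\in\mathbb{F}^{M\times N}$ be a TQS matrix on $\mathbb{G}$ with rank-profile $\{\rho_e\}_{e\in\mathbb{E}}$. Then the pair $(\mathrm{T},\mathbb{G})$ satisfies the GIRS-property for the constant $c=\max_{e\in\mathbb{E}}\rho_e$.
   Context: $\mathbb{F}$ is a field. $\mathbb{G}=(\mathbb{V},\mathbb{E})$ is a finite connected acyclic undirected graph (a tree) with $\mathbb{V}=\{1,\dots,K\}$. The edge set $\mathbb{E}$ is regarded as a set of ordered pairs with $(i,j)\in\mathbb{E}$ iff $(j,i)\in\mathbb{E}$ (both orientations of each edge are included; no loops). $\mathcal{N}(i)$ is the set of neighbors of $i$. Any two distinct nodes are joined by a unique (non-self-intersecting) path. Graph-partitioned matrix: each node $i$ has an input dimension $n_i\ge 0$ and an output dimension $m_i\ge 0$ (integers, zero allowed); $M=\sum_i m_i$, $N=\sum_i n_i$. A matrix $\mathrm{T}\in\mathbb{F}^{M\times N}$ is block-partitioned with blocks $\mathrm{T}\{i,j\}\in\mathbb{F}^{m_i\times n_j}$, $i,j\in\mathbb{V}$. For $\mathbb{A},\mathbb{B}\subset\mathbb{V}$, $\mathrm{T}\{\mathbb{A},\mathbb{B}\}$ is the submatrix of blocks with block-row indices in $\mathbb{A}$ and block-column indices in $\mathbb{B}$. The pair $(\mathrm{T},\mathbb{G})$ is a graph-partitioned matrix. TQS matrix: given nonnegative integer weights $\{\rho_e\}_{e\in\mathbb{E}}$ (the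 rank-profile; $\rho_{(i,j)}$ and $\rho_{(j,i)}$ may differ), $\mathrm{T}$ is a tree quasi-separable (TQS) matrix on $\mathbb{G}$ with input dimensions $\{n_i\}$, output dimensions $\{m_i\}$ and rank-profile $\{\rho_e\}$ if there exist matrices $\mathrm{D}^k\in\mathbb{F}^{m_k\times n_k}$ ($k\in\mathbb{V}$), $\mathrm{Inp}^k_j\in\mathbb{F}^{\rho_{(k,j)}\times n_k}$ ($(k,j)\in\mathbb{E}$), $\mathrm{Trans}^k_{i,j}\in\mathbb{F}^{\rho_{(k,i)}\times\rho_{(j,k)}}$ ($i\neq j$ in $\mathcal{N}(k)$), $\mathrm{Out}^k_i\in\mathbb{F}^{m_k\times\rho_{(i,k)}}$ ($(i,k)\in\mathbb{E}$) such that $\mathrm{T}\{i,i\}=\mathrm{D}^i$ and, for $i\ne j$ with unique path $j=p_0-p_1-\cdots-p_\nu=i$, $$\mathrm{T}\{i,j\}=\mathrm{Out}^i_{p_{\nu-1}}\,\mathrm{Trans}^{p_{\nu-1}}_{i,p_{\nu-2}}\cdots\mathrm{Trans}^{p_2}_{p_3,p_1}\,\mathrm{Trans}^{p_1}_{p_2,j}\,\mathrm{Inp}^j_{p_1}$$ (for $\nu=1$ this reads $\mathrm{Out}^i_j\,\mathrm{Inp}^j_i$). GIRS-property: for $\mathbb{A}\subset\mathbb{V}$ put $\bar{\mathbb{A}}=\mathbb{V}\setminus\mathbb{A}$; let $\mathcal{E}(\mathbb{A})$ be the number of border edges of $\mathbb{A}$, i.e. of edges $(i,j)\in\mathbb{E}$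 with $i\in\mathbb{A}$, $j\in\bar{\mathbb{A}}$. The pair $(\mathrm{T},\mathbb{G})$ satisfies the graph-induced rank structure (GIRS) property for a constant $c\ge 0$ if $\operatorname{rank}\mathrm{T}\{\bar{\mathbb{A}},\mathbb{A}\}\le c\,\mathcal{E}(\mathbb{A})$ for all $\mathbb{A}\subset\mathbb{V}$. A maximum over an empty edge set is read as $0$. *)

theory Defs
  imports
    "Graph_Theory.Graph_Theory"
    "Jordan_Normal_Form.DL_Rank_Submatrix"
begin

text \<open>An undirected graph is a \<open>pair_graph\<close>: finite, loop-free, and containing both orientations
  of every edge. The library's \<open>tree\<close> is unsuitable here, since in a symmetric digraph
  \<open>u, v, u\<close> already counts as a \<open>cycle\<close>; a cycle of an undirected graph
  has at least three edges.\<close>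

definition undirected_acyclic :: "'v pair_pre_digraph \<Rightarrow> bool" where
  "undirected_acyclic G \<longleftrightarrow>
     \<not> (\<exists>p. pre_digraph.cycle (with_proj G) p \<and> 3 \<le> length p)"

definition undirected_tree :: "'v pair_pre_digraph \<Rightarrow> bool" where
  "undirected_tree G \<longleftrightarrow>
     pair_graph G \<and> Digraph_Component.connected (with_proj G) \<and> undirected_acyclic G"

text \<open>Nodes are numbered from 1, whereas rows and columns of a matrix are numbered from 0.
  If \<open>d k\<close> is the size of block \<open>k\<close>, then block \<open>i\<close> occupies the positions
  \<open>d 1 + \<dots> + d (i - 1), \<dots>, d 1 + \<dots> + d i - 1\<close>.\<close>

definition block_indices :: "(nat \<Rightarrow> nat) \<Rightarrow> nat \<Rightarrow> nat set" where
  "block_indices d i = {(\<Sum>k\<in>{1..<i}. d k) ..< (\<Sum>k\<in>{1..i}. d k)}"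

text \<open>\<open>subblock m n T A B\<close> is the submatrix \<open>T{A, B}\<close>, for output (row) dimensions \<open>m\<close> and input (column)
  dimensions \<open>n\<close>.\<close>

definition subblock ::
  "(nat \<Rightarrow> nat) \<Rightarrow> (nat \<Rightarrow> nat) \<Rightarrow> 'a mat \<Rightarrow> nat set \<Rightarrow> nat set \<Rightarrow> 'a mat" where
  "subblock m n T A B =
     submatrix T (\<Union>i\<in>A. block_indices m i) (\<Union>j\<in>B. block_indices n j)"

definition graph_partitioned ::
  "nat pair_pre_digraph \<Rightarrow> (nat \<Rightarrow> nat) \<Rightarrow> (nat \<Rightarrow> nat) \<Rightarrow> 'a mat \<Rightarrow> bool" where
  "graph_partitioned G m n T \<longleftrightarrow>
     T \<in> carrier_mat (\<Sum>i\<in>pverts G. m i) (\<Sum>j\<in>pverts G. n j)"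

text \<open>\<open>Trans k i j\<close>, \<open>Inp k j\<close>, \<open>Out k i\<close> stand for
  the generators with superscript \<open>k\<close> and these subscripts. For a path \<open>p = [p\<^sub>0, \<dots>, p\<^sub>\<nu>]\<close>,
  \<open>transport Trans p X\<close> is
  \<open>Trans p\<^bsub>\<nu>-1\<^esub> p\<^bsub>\<nu>\<^esub> p\<^bsub>\<nu>-2\<^esub> * \<dots> * Trans p\<^sub>1 p\<^sub>2 p\<^sub>0 * X\<close>.\<close>

fun transport ::
  "(nat \<Rightarrow> nat \<Rightarrow> nat \<Rightarrow> 'a::field mat) \<Rightarrow> nat list \<Rightarrow> 'a mat \<Rightarrow> 'a mat" where
  "transport Trans (a # b # c # p) X = transport Trans (b # c # p) (Trans b c a * X)"
| "transport Trans [a, b] X = X"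
| "transport Trans [a] X = X"
| "transport Trans [] X = X"

definition tqs ::
  "nat pair_pre_digraph \<Rightarrow> (nat \<Rightarrow> nat) \<Rightarrow> (nat \<Rightarrow> nat) \<Rightarrow> (nat \<times> nat \<Rightarrow> nat) \<Rightarrow>
   'a::field mat \<Rightarrow> bool" where
  "tqs G m n \<rho> T \<longleftrightarrow>
     graph_partitioned G m n T \<and>
     (\<exists>D Inp Trans Out.
        (\<forall>k\<in>pverts G. D k \<in> carrier_mat (m k) (n k)) \<and>
        (\<forall>k j. (k, j) \<in> parcs G \<longrightarrow> Inp k j \<in> carrier_mat (\<rho> (k, j)) (n k)) \<and>
        (\<forall>k i j. (k, i) \<in> parcs G \<and> (j, k) \<in> parcs G \<and> i \<noteq> j \<longrightarrow>
           Trans k i j \<in> carrier_mat (\<rho> (k, i)) (\<rho> (j, k))) \<and>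
        (\<forall>k i. (i, k) \<in> parcs G \<longrightarrow> Out k i \<in> carrier_mat (m k) (\<rho> (i, k))) \<and>
        (\<forall>i\<in>pverts G. subblock m n T {i} {i} = D i) \<and>
        (\<forall>i\<in>pverts G. \<forall>j\<in>pverts G. \<forall>p.
           i \<noteq> j \<and> vpath p (with_proj G) \<and> hd p = j \<and> last p = i \<longrightarrow>
           subblock m n T {i} {j} =
             Out i (p ! (length p - 2)) * transport Trans p (Inp j (p ! 1))))"

text \<open>\<open>vec_space.rank\<close> is the dimension of the column space; its first argument is the
  length of the columns.\<close>

definition mat_rank :: "'a::field mat \<Rightarrow> nat" where
  "mat_rank A = vec_space.rank (dim_row A) A"

definition border_edges :: "'v pair_pre_digraph \<Rightarrow> 'v set \<Rightarrow> nat" where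
  "border_edges G A = card {(i, j). (i, j) \<in> parcs G \<and> i \<in> A \<and> j \<in> pverts G - A}"

definition girs ::
  "nat pair_pre_digraph \<Rightarrow> (nat \<Rightarrow> nat) \<Rightarrow> (nat \<Rightarrow> nat) \<Rightarrow> 'a::field mat \<Rightarrow> real \<Rightarrow> bool" where
  "girs G m n T c \<longleftrightarrow>
     0 \<le> c \<and>
     (\<forall>A. A \<subseteq> pverts G \<longrightarrow>
        real (mat_rank (subblock m n T (pverts G - A) A)) \<le> c * real (border_edges G A))"

text \<open>The maximum over an empty edge set is read as 0.\<close>

definition max_weight :: "'v pair_pre_digraph \<Rightarrow> ('v \<times> 'v \<Rightarrow> nat) \<Rightarrow> nat" where
  "max_weight G \<rho> = (if parcs G = {} then 0 else Max (\<rho> ` parcs G))"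

end

theory Submission
  imports Defs
begin

text \<open>
  A path in the tree that starts in \<open>A\<close> and ends outside \<open>A\<close> has a unique first arc \<open>e\<close> that leaves
  \<open>A\<close>. Cutting the path there splits the product of generators that forms the block \<open>T{t, s}\<close> at a
  space of dimension \<open>\<rho> e\<close>: it becomes \<open>X e t * Y e s\<close>, where \<open>Y e s\<close> collects the
  generators up to the cut and \<open>X e t\<close> those after it. Set \<open>Y e s\<close> to zero if no
  path from \<open>s\<close> stays in \<open>A\<close> until it crosses \<open>e\<close>, and \<open>X e t\<close> to zero if no path to \<open>t\<close> begins
  with \<open>e\<close>. Then \<open>T{t, s}\<close> is the sum of \<open>X e t * Y e s\<close> over all border arcs \<open>e\<close>, because at most
  one summand is nonzero (\<open>tqs_block_factorization\<close>). So the
  submatrix of \<open>T\<close> from \<open>A\<close> to its complement factors through a space whose dimension is the sum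
  of the weights of the border arcs, which is at most the number of border arcs times the largest
  weight.

  That at most one summand survives is where acyclicity enters, twice. A path ending with the arc
  \<open>(a, b)\<close> and a path starting with it join to a path, since they could only meet again along a
  cycle (\<open>undirected_tree_vpath_join\<close>). Hence if both factors for \<open>e\<close> are nonzero, \<open>e\<close> lies
  on a path from \<open>s\<close> to \<open>t\<close>; there is only one such path
  (\<open>undirected_tree_vpath_unique\<close>), and its first exit from \<open>A\<close> is determined.

  Rank bounds are obtained from formulas for the entries (\<open>rank_subblock_le\<close>), so that no block
  matrices have to be assembled.
\<close>

section \<open>Rank of a sum of products\<close>

text \<open>Each summand contributes a matrix of rank at most one, and rank is subadditive.\<close>

lemma (in vec_space) rank_le_card_products:
  assumes "finite S" and "A \<in> carrier_mat n nc"
    and "\<And>i j. i < n \<Longrightarrow> j < nc \<Longrightarrow> A $$ (i, j) = (\<Sum>x\<in>S. f x i * g x j)"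
  shows "rank A \<le> card S"
  using assms
proof (induction S arbitrary: A rule: finite_induct)
  case empty
  then have "A = 0\<^sub>m n nc" by (intro eq_matI) auto
  then show ?case by (simp add: rank_0I)
next
  case (insert x S)
  define B where "B = mat n nc (\<lambda>(i, j). f x i * g x j)"
  define C where "C = mat n nc (\<lambda>(i, j). \<Sum>x\<in>S. f x i * g x j)"
  have carriers: "B \<in> carrier_mat n nc" "C \<in> carrier_mat n nc"
    by (simp_all add: B_def C_def)
  have "A = B + C"
    using insert by (intro eq_matI) (auto simp: B_def C_def)
  then have "rank A \<le> rank B + rank C"
    using rank_subadditive[OF carriers] by simp
  also have "rank B \<le> 1"
    by (rule rank_le_1_product_entries[OF carriers(1), of "f x" "g x"]) (auto simp: B_def)
  also have "rank C \<le> card S"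
    by (rule insert.IH[OF carriers(2)]) (auto simp: C_def)
  finally show ?case using insert by simp
qed

section \<open>Paths in an undirected tree\<close>

lemma vpath_append_iff:
  assumes "p \<noteq> []" and "q \<noteq> []"
  shows "vpath (p @ q) G \<longleftrightarrow>
    vpath p G \<and> vpath q G \<and> (last p, hd q) \<in> arcs_ends G \<and> set p \<inter> set q = {}"
  using assms by (auto simp: vpath_def vwalk_def vwalk_arcs_append)

lemma vpath_Cons_Cons:
  "vpath (a # b # p) G \<longleftrightarrow>
    vpath (b # p) G \<and> (a, b) \<in> arcs_ends G \<and> a \<in> verts G \<and> a \<notin> set (b # p)"
  by (auto simp: vpath_def vwalk_def)

lemma vpath_rev:
  assumes "symmetric G" and "vpath p G"
  shows "vpath (rev p) G"
  using assms unfolding vpath_def vwalk_def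
  by (auto simp: set_vwalk_arcs_rev symmetric_def sym_def)

lemma vpath_nth_arc:
  assumes "vpath p G" and "Suc i < length p"
  shows "(p ! i, p ! Suc i) \<in> arcs_ends G"
  using assms
proof (induction p arbitrary: i rule: vwalk_arcs.induct)
  case (3 x y xs)
  then show ?case by (cases i) (auto simp: vpath_Cons_Cons)
qed auto

lemma ends_of_vwalk_arcs:
  "pawalk_verts u (vwalk_arcs (u # p)) = u # p"
  "pcas u (vwalk_arcs (u # p)) (last (u # p))"
  by (induction p arbitrary: u) auto

lemma closed_vwalk_imp_cycle:
  assumes "vwalk (u # p @ [u]) (with_proj G)" and "distinct (p @ [u])"
  shows "pre_digraph.cycle (with_proj G) (vwalk_arcs (u # p @ [u]))"
proof -
  have "pre_digraph.awalk (with_proj G) u (vwalk_arcs (u # p @ [u])) u"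
    unfolding pre_digraph.awalk_def
    using assms(1) ends_of_vwalk_arcs(2)[of u "p @ [u]"]
    by (simp add: vwalk_def cas_with_proj_eq)
  then show ?thesis
    unfolding pre_digraph.cycle_def
    using assms(2) ends_of_vwalk_arcs(1)[of u "p @ [u]"]
    by (auto simp: awalk_verts_with_proj_eq simp del: vwalk_arcs_Cons)
qed

lemma undirected_tree_symmetric: "undirected_tree G \<Longrightarrow> symmetric (with_proj G)"
  by (simp add: undirected_tree_def pair_graph_def pair_pseudo_graph_def pair_sym_digraph_def
      pair_sym_digraph_axioms_def)

lemma undirected_tree_vpath_exists:
  assumes "undirected_tree G" and "u \<in> pverts G" and "v \<in> pverts G"
  shows "\<exists>p. vpath p (with_proj G) \<and> hd p = u \<and> last p = v"
proof -
  interpret pair_graph G using assms(1) by (simp add: undirected_tree_def)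
  have "strongly_connected (with_proj G)"
    using assms(1) undirected_tree_symmetric[OF assms(1)]
    by (intro symmetric_connected_imp_strongly_connected) (auto simp: undirected_tree_def)
  then have "u \<rightarrow>\<^sup>*\<^bsub>with_proj G\<^esub> v" using assms by (auto simp: strongly_connected_def)
  then obtain p where "vwalk p (with_proj G)" "hd p = u" "last p = v"
    by (auto simp: reachable_vwalk_conv)
  then show ?thesis by (rule vwalk_imp_ex_vpath)
qed

text \<open>Follow two paths with common ends until they part. The first vertex of one path after this point
  that lies on the other one closes a cycle. Its length is at least three because the two paths leave
  the parting point through different neighbours.\<close>

lemma undirected_tree_vpath_unique:
  assumes "undirected_tree G"
    and "vpath p (with_proj G)" and "vpath q (with_proj G)"
    and "hd p = hd q" and "last p = last q"
  shows "p = q"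
  using assms(2-)
proof (induction p arbitrary: q)
  case Nil
  then show ?case by (simp add: vpath_def vwalk_def)
next
  case (Cons u p)
  obtain q' where q: "q = u # q'"
    using Cons.prems by (cases q) (auto simp: vpath_def vwalk_def)
  show ?case
  proof (cases "p = [] \<or> q' = []")
    case True
    have "u \<notin> set p" "u \<notin> set q'" using Cons.prems(1,2) q by (simp_all add: vpath_def)
    then show ?thesis using True Cons.prems(4) q last_in_set[of p] last_in_set[of q']
      by (auto simp del: last_in_set split: if_split_asm)
  next
    case False
    then have ne: "p \<noteq> []" "q' \<noteq> []" by auto
    have p: "vpath p (with_proj G)"
      using Cons.prems(1) vpath_append_iff[of "[u]" p "with_proj G"] ne by simp
    have q': "vpath q' (with_proj G)"
      using Cons.prems(2) q vpath_append_iff[of "[u]" q' "with_proj G"] ne by simp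
    have last_eq: "last p = last q'" using Cons.prems(4) q ne by simp
    have "hd p = hd q'"
    proof (rule ccontr)
      assume hd_ne: "hd p \<noteq> hd q'"
      have "\<exists>z\<in>set p. z \<in> set q'" using last_eq ne by (metis last_in_set)
      then obtain p1 z p2 where p_split: "p = p1 @ z # p2"
        and z: "z \<in> set q'" and p1: "\<forall>y\<in>set p1. y \<notin> set q'"
        by (rule split_list_first_propE)
      obtain q1 q2 where q_split: "q' = q1 @ z # q2" using z by (metis split_list)
      have sym: "symmetric (with_proj G)" by (rule undirected_tree_symmetric[OF assms(1)])
      have out: "vpath ((u # p1) @ [z]) (with_proj G)"
        using Cons.prems(1) p_split vpath_append_iff[of "(u # p1) @ [z]" p2 "with_proj G"]
        by (cases "p2 = []") simp_all
      have "vpath (u # q1 @ [z]) (with_proj G)"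
        using Cons.prems(2) q q_split vpath_append_iff[of "u # q1 @ [z]" q2 "with_proj G"]
        by (cases "q2 = []") simp_all
      from vpath_rev[OF sym this] have return: "vpath (z # rev q1 @ [u]) (with_proj G)" by simp
      have closed: "vwalk (u # (p1 @ z # rev q1) @ [u]) (with_proj G)"
        using out return vwalk_arcs_append[of "u # p1" "[z]"]
          vwalk_arcs_append[of "u # p1" "z # rev q1 @ [u]"]
        unfolding vpath_def vwalk_def by (simp del: vwalk_arcs_Cons)
      have "set p1 \<inter> set q1 = {}" using p1 q_split by auto
      then have dist: "distinct ((p1 @ z # rev q1) @ [u])"
        using out return unfolding vpath_def by auto
      have "p1 \<noteq> [] \<or> q1 \<noteq> []" using hd_ne p_split q_split by auto
      then have "3 \<le> vwalk_length (u # (p1 @ z # rev q1) @ [u])"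
        by (cases p1; cases q1) auto
      then show False
        using closed_vwalk_imp_cycle[OF closed dist] assms(1)
        unfolding undirected_tree_def undirected_acyclic_def vwalk_length_def by blast
    qed
    then show ?thesis using Cons.IH[OF p q' _ last_eq] q by simp
  qed
qed

text \<open>If the part up to \<open>a\<close> met the part from \<open>b\<close> on in a vertex \<open>z\<close>, then there would be a path from
  \<open>z\<close> to \<open>b\<close> that passes through \<open>a\<close> and another one that does not.\<close>

lemma undirected_tree_vpath_join:
  assumes tree: "undirected_tree G"
    and p: "vpath (p @ [a, b]) (with_proj G)" and q: "vpath (a # b # q) (with_proj G)"
  shows "vpath (p @ [a, b] @ q) (with_proj G)"
proof -
  have "set (p @ [a]) \<inter> set (b # q) = {}"
  proof (rule ccontr)
    assume "set (p @ [a]) \<inter> set (b # q) \<noteq> {}"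
    then obtain z where z: "z \<in> set (p @ [a])" "z \<in> set (b # q)" by blast
    obtain p1 p2 where p_split: "p @ [a] = p1 @ z # p2" using split_list[OF z(1)] by blast
    obtain q1 q2 where q_split: "b # q = q1 @ z # q2" using split_list[OF z(2)] by blast
    have "p @ [a, b] = p1 @ (z # p2 @ [b])"
      using p_split by (metis append.assoc append_Cons append_Nil)
    with p have "vpath (p1 @ (z # p2 @ [b])) (with_proj G)" by simp
    then have via_a: "vpath (z # p2 @ [b]) (with_proj G)"
      using vpath_append_iff[of p1 "z # p2 @ [b]" "with_proj G"] by (cases "p1 = []") auto
    have "vpath (b # q) (with_proj G)" using q by (simp add: vpath_Cons_Cons)
    then have "vpath (q1 @ [z]) (with_proj G)"
      using q_split vpath_append_iff[of "q1 @ [z]" q2 "with_proj G"] by (cases q2) auto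
    then have avoiding_a: "vpath (rev (q1 @ [z])) (with_proj G)"
      by (rule vpath_rev[OF undirected_tree_symmetric[OF tree]])
    have "hd (q1 @ [z]) = b" using q_split by (cases q1) auto
    then have "last (rev (q1 @ [z])) = b" by (simp only: last_rev)
    then have "z # p2 @ [b] = rev (q1 @ [z])"
      using undirected_tree_vpath_unique[OF tree via_a avoiding_a] by simp
    then have "set (z # p2) \<subseteq> set (b # q)" using q_split
      by (metis Un_iff append_Cons set_append set_rev subsetI append.assoc append_Nil)
    moreover have "a \<in> set (z # p2)"
      using p_split by (metis last_appendR last_in_set last_snoc list.distinct(1))
    ultimately show False using q by (auto simp: vpath_Cons_Cons)
  qed
  then show ?thesis
    using p q vpath_append_iff[of "p @ [a]" "[b]" "with_proj G"]
      vpath_append_iff[of "p @ [a]" "b # q" "with_proj G"]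
    by (simp add: vpath_Cons_Cons)
qed

section \<open>Leaving a vertex set\<close>

text \<open>The lists \<open>p\<close> and \<open>q\<close> in the next two predicates omit the arc \<open>e\<close> itself, so that
  \<open>p @ [fst e, snd e] @ q\<close> is the whole path cut at \<open>e\<close>.\<close>

definition exit_path ::
  "'v pair_pre_digraph \<Rightarrow> 'v set \<Rightarrow> 'v \<Rightarrow> 'v \<times> 'v \<Rightarrow> 'v list \<Rightarrow> bool" where
  "exit_path G A s e p \<longleftrightarrow>
     vpath (p @ [fst e, snd e]) (with_proj G) \<and> hd (p @ [fst e]) = s \<and> set (p @ [fst e]) \<subseteq> A"

definition onward_path ::
  "'v pair_pre_digraph \<Rightarrow> 'v \<Rightarrow> 'v \<times> 'v \<Rightarrow> 'v list \<Rightarrow> bool" where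
  "onward_path G t e q \<longleftrightarrow>
     vpath (fst e # snd e # q) (with_proj G) \<and> last (snd e # q) = t"

definition border_arcs :: "'v pair_pre_digraph \<Rightarrow> 'v set \<Rightarrow> ('v \<times> 'v) set" where
  "border_arcs G A = {(i, j). (i, j) \<in> parcs G \<and> i \<in> A \<and> j \<in> pverts G - A}"

lemma first_exit_exists:
  assumes tree: "undirected_tree G" and A: "A \<subseteq> pverts G"
    and s: "s \<in> A" and t: "t \<in> pverts G - A"
  shows "\<exists>e\<in>border_arcs G A. \<exists>p q. exit_path G A s e p \<and> onward_path G t e q"
proof -
  obtain r where r: "vpath r (with_proj G)" "hd r = s" "last r = t"
    using undirected_tree_vpath_exists[OF tree, of s t] A s t by blast
  have "r \<noteq> []" using r(1) by (auto simp: vpath_def vwalk_def)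
  then have "\<exists>x\<in>set r. x \<notin> A" using r(3) t by (metis DiffD2 last_in_set)
  then obtain p' b q where split: "r = p' @ b # q" and b: "b \<notin> A" and p': "\<forall>y\<in>set p'. \<not> y \<notin> A"
    by (rule split_list_first_propE)
  have "p' \<noteq> []" using split b r(2) s by auto
  then obtain p a where p: "p' = p @ [a]" by (metis rev_exhaust)
  have r': "r = p @ [a] @ [b] @ q" using split p by simp
  have "vpath (p @ [a, b]) (with_proj G)"
    using r(1) r' vpath_append_iff[of "p @ [a, b]" q "with_proj G"] by (cases q) auto
  moreover have "hd (p @ [a]) = s" using r(2) r' by (cases p) simp_all
  moreover have "set (p @ [a]) \<subseteq> A" using p' p by blast
  ultimately have exit: "exit_path G A s (a, b) p"
    unfolding exit_path_def fst_conv snd_conv by (intro conjI)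
  have "vpath (a # b # q) (with_proj G)"
    using r(1) r' vpath_append_iff[of p "a # b # q" "with_proj G"] by (cases p) auto
  moreover have "last (b # q) = t" using r(3) r' by simp
  ultimately have onward: "onward_path G t (a, b) q"
    unfolding onward_path_def fst_conv snd_conv by (intro conjI)
  have "(a, b) \<in> border_arcs G A"
    using exit onward b
    by (auto simp: exit_path_def onward_path_def border_arcs_def vpath_Cons_Cons vpath_def vwalk_def)
  then show ?thesis using exit onward by (intro bexI[of _ "(a, b)"] exI conjI)
qed

text \<open>Both decompositions join to the path from \<open>s\<close> to \<open>t\<close>, and the part of it before the
  cut is recovered as its longest prefix inside \<open>A\<close>.\<close>

lemma first_exit_unique:
  assumes tree: "undirected_tree G"
    and e: "e \<in> border_arcs G A" "exit_path G A s e p" "onward_path G t e q"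
    and e': "e' \<in> border_arcs G A" "exit_path G A s e' p'" "onward_path G t e' q'"
  shows "e = e' \<and> p = p' \<and> q = q'"
proof -
  obtain a b a' b' where ab: "e = (a, b)" "e' = (a', b')" by fastforce
  have "p @ [a, b] @ q = p' @ [a', b'] @ q'"
  proof (rule undirected_tree_vpath_unique[OF tree])
    show "vpath (p @ [a, b] @ q) (with_proj G)"
      using undirected_tree_vpath_join[OF tree] e ab by (auto simp: exit_path_def onward_path_def)
    show "vpath (p' @ [a', b'] @ q') (with_proj G)"
      using undirected_tree_vpath_join[OF tree] e' ab by (auto simp: exit_path_def onward_path_def)
    show "hd (p @ [a, b] @ q) = hd (p' @ [a', b'] @ q')"
      using e(2) e'(2) ab by (cases p; cases p') (simp_all add: exit_path_def)
    show "last (p @ [a, b] @ q) = last (p' @ [a', b'] @ q')"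
      using e(3) e'(3) ab by (simp add: onward_path_def)
  qed
  then have eq: "(p @ [a]) @ b # q = (p' @ [a']) @ b' # q'" by simp
  have tw: "takeWhile (\<lambda>x. x \<in> A) ((p @ [a]) @ b # q) = p @ [a]"
    using e(1,2) ab by (simp add: takeWhile_append exit_path_def border_arcs_def subset_eq)
  have tw': "takeWhile (\<lambda>x. x \<in> A) ((p' @ [a']) @ b' # q') = p' @ [a']"
    using e'(1,2) ab by (simp add: takeWhile_append exit_path_def border_arcs_def subset_eq)
  have "p @ [a] = p' @ [a']" using tw tw' unfolding eq by simp
  then show ?thesis using eq ab by simp
qed

section \<open>Transport along a path\<close>

lemma transport_append:
  "transport Trans (p @ [a, b] @ q) X = transport Trans (a # b # q) (transport Trans (p @ [a, b]) X)"
proof (induction Trans p X rule: transport.induct)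
  case (2 Trans x y X)
  then show ?case by simp
qed auto

text \<open>Transport only multiplies from the left, so it commutes with multiplication from the right.
  Applied to \<open>X = 1\<close>, this turns the generators along a path into a matrix that does not depend on
  what is transported.\<close>

lemma transport_mult:
  assumes Trans: "\<forall>k i j. (k, i) \<in> parcs G \<and> (j, k) \<in> parcs G \<and> i \<noteq> j \<longrightarrow>
      Trans k i j \<in> carrier_mat (\<rho> (k, i)) (\<rho> (j, k))"
    and "vpath p (with_proj G)" and "2 \<le> length p"
    and "X \<in> carrier_mat (\<rho> (p ! 0, p ! 1)) k" and "Y \<in> carrier_mat k l"
  shows "transport Trans p X \<in> carrier_mat (\<rho> (p ! (length p - 2), last p)) k \<and>
    transport Trans p (X * Y) = transport Trans p X * Y"
  using assms
proof (induction Trans p X rule: transport.induct)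
  case (1 Trans a b c p X)
  have arcs: "(b, c) \<in> parcs G" "(a, b) \<in> parcs G" "c \<noteq> a" "vpath (b # c # p) (with_proj G)"
    using "1.prems"(2) by (auto simp: vpath_Cons_Cons)
  then have t: "Trans b c a \<in> carrier_mat (\<rho> (b, c)) (\<rho> (a, b))"
    using "1.prems"(1) by blast
  have X: "X \<in> carrier_mat (\<rho> (a, b)) k" using "1.prems"(4) by simp
  have "Trans b c a * X \<in> carrier_mat (\<rho> ((b # c # p) ! 0, (b # c # p) ! 1)) k"
    using t X by simp
  moreover have "Trans b c a * (X * Y) = Trans b c a * X * Y"
    using t X "1.prems"(5) by (simp add: assoc_mult_mat)
  ultimately show ?case
    using "1.IH"[OF "1.prems"(1) arcs(4)] "1.prems"(5) by (simp add: nth_Cons')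
qed auto

section \<open>Factorization through the border\<close>

text \<open>The factor \<open>X e t\<close> does not depend on \<open>s\<close>, and \<open>Y e s\<close> does not depend on \<open>t\<close>. This separation
  of source and target is what bounds the rank of the whole submatrix, not only of its blocks.\<close>

lemma tqs_block_factorization:
  fixes T :: "'a::field mat"
  assumes tree: "undirected_tree G" and tqs: "tqs G m n \<rho> T" and A: "A \<subseteq> pverts G"
  obtains X Y :: "nat \<times> nat \<Rightarrow> nat \<Rightarrow> 'a mat" where
    "\<And>s t r c. s \<in> A \<Longrightarrow> t \<in> pverts G - A \<Longrightarrow> r < m t \<Longrightarrow> c < n s \<Longrightarrow>
       subblock m n T {t} {s} $$ (r, c) =
         (\<Sum>e\<in>border_arcs G A. \<Sum>l<\<rho> e. X e t $$ (r, l) * Y e s $$ (l, c))"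
proof -
  interpret pair_graph G using tree by (simp add: undirected_tree_def)
  obtain D Inp Trans Out where
    Inp: "\<forall>k j. (k, j) \<in> parcs G \<longrightarrow> Inp k j \<in> carrier_mat (\<rho> (k, j)) (n k)" and
    Trans: "\<forall>k i j. (k, i) \<in> parcs G \<and> (j, k) \<in> parcs G \<and> i \<noteq> j \<longrightarrow>
           Trans k i j \<in> carrier_mat (\<rho> (k, i)) (\<rho> (j, k))" and
    Out: "\<forall>k i. (i, k) \<in> parcs G \<longrightarrow> Out k i \<in> carrier_mat (m k) (\<rho> (i, k))" and
    off_diagonal: "\<forall>i\<in>pverts G. \<forall>j\<in>pverts G. \<forall>p.
           i \<noteq> j \<and> vpath p (with_proj G) \<and> hd p = j \<and> last p = i \<longrightarrow>
           subblock m n T {i} {j} =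
             Out i (p ! (length p - 2)) * transport Trans p (Inp j (p ! 1))"
    using tqs unfolding tqs_def by blast
  define Yp where "Yp e s p = transport Trans (p @ [fst e, snd e]) (Inp s ((p @ [fst e, snd e]) ! 1))"
    for e s p
  define Xq where "Xq e t q = Out t ((fst e # snd e # q) ! length q) *
      transport Trans (fst e # snd e # q) (1\<^sub>m (\<rho> e))" for e t q
  define Y where "Y e s = (if \<exists>p. exit_path G A s e p
      then Yp e s (SOME p. exit_path G A s e p) else 0\<^sub>m (\<rho> e) (n s))" for e s
  define X where "X e t = (if \<exists>q. onward_path G t e q
      then Xq e t (SOME q. onward_path G t e q) else 0\<^sub>m (m t) (\<rho> e))" for e t
  have "subblock m n T {t} {s} $$ (r, c) =
         (\<Sum>e\<in>border_arcs G A. \<Sum>l<\<rho> e. X e t $$ (r, l) * Y e s $$ (l, c))"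
    if st: "s \<in> A" "t \<in> pverts G - A" and rc: "r < m t" "c < n s" for s t r c
  proof -
    obtain e p q where e: "e \<in> border_arcs G A"
      and p: "exit_path G A s e p" and q: "onward_path G t e q"
      using first_exit_exists[OF tree A st] by blast
    have unique: "e' = e \<and> p' = p \<and> q' = q"
      if "e' \<in> border_arcs G A" "exit_path G A s e' p'" "onward_path G t e' q'" for e' p' q'
      using first_exit_unique[OF tree that e p q] .
    obtain a b where ab: "e = (a, b)" by (cases e)
    have vp: "vpath (p @ [a, b]) (with_proj G)" and vq: "vpath (a # b # q) (with_proj G)"
      and hd_p: "hd (p @ [a, b]) = s" and last_q: "last (b # q) = t"
      using p q ab by (auto simp: exit_path_def onward_path_def hd_append)
    \<comment> \<open>The path from \<open>s\<close> to \<open>t\<close> along which \<open>T{t, s}\<close> is defined.\<close>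
    let ?r = "p @ [a, b] @ q"
    have r: "vpath ?r (with_proj G)" by (rule undirected_tree_vpath_join[OF tree vp vq])
    have s0: "(p @ [a, b]) ! 0 = s" using hd_p by (simp add: hd_conv_nth)
    have t1: "(a # b # q) ! Suc (length q) = t" using last_q last_conv_nth[of "b # q"] by simp
    \<comment> \<open>The neighbours of \<open>s\<close> and \<open>t\<close> on this path.\<close>
    let ?s' = "(p @ [a, b]) ! 1" and ?t' = "(a # b # q) ! length q"
    have Inp_s: "Inp s ?s' \<in> carrier_mat (\<rho> (s, ?s')) (n s)"
      using Inp vpath_nth_arc[OF vp, of 0] s0 by simp
    have Out_t: "Out t ?t' \<in> carrier_mat (m t) (\<rho> (?t', t))"
      using Out vpath_nth_arc[OF vq, of "length q"] t1 by simp
    have Yp: "Yp e s p \<in> carrier_mat (\<rho> e) (n s)"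
      using transport_mult[where Y = "1\<^sub>m (n s)", OF Trans vp _ _ one_carrier_mat] Inp_s s0
      by (simp add: Yp_def ab nth_append)
    have "transport Trans (a # b # q) (1\<^sub>m (\<rho> e)) \<in> carrier_mat (\<rho> (?t', t)) (\<rho> e) \<and>
      transport Trans (a # b # q) (1\<^sub>m (\<rho> e) * Yp e s p) =
        transport Trans (a # b # q) (1\<^sub>m (\<rho> e)) * Yp e s p"
      using transport_mult[OF Trans vq _ _ Yp, of "1\<^sub>m (\<rho> e)"] last_q by (simp add: ab)
    then have onward: "transport Trans (a # b # q) (1\<^sub>m (\<rho> e)) \<in> carrier_mat (\<rho> (?t', t)) (\<rho> e)"
      "transport Trans (a # b # q) (Yp e s p) =
        transport Trans (a # b # q) (1\<^sub>m (\<rho> e)) * Yp e s p"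
      using Yp by simp_all
    have Xq: "Xq e t q \<in> carrier_mat (m t) (\<rho> e)"
      using Out_t onward(1) by (simp add: Xq_def ab)
    have "subblock m n T {t} {s} = Out t (?r ! (length ?r - 2)) * transport Trans ?r (Inp s (?r ! 1))"
    proof -
      have "hd ?r = s" "last ?r = t"
        using hd_p last_q by (auto simp: hd_append)
      moreover have "t \<noteq> s" "s \<in> pverts G" "t \<in> pverts G" using st A by auto
      ultimately show ?thesis
        using r by (intro off_diagonal[rule_format, of t s ?r] conjI)
    qed
    also have "?r ! 1 = ?s'" using nth_append_left[of 1 "p @ [a, b]" q] by simp
    also have "?r ! (length ?r - 2) = ?t'"
      using nth_append_length_plus[of p "a # b # q" "length q"] by simp
    also have "transport Trans ?r (Inp s ?s') = transport Trans (a # b # q) (Yp e s p)"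
      by (simp only: transport_append Yp_def ab fst_conv snd_conv)
    also have "Out t ?t' * \<dots> = Xq e t q * Yp e s p"
      unfolding onward(2) using Out_t onward(1) Yp by (simp add: Xq_def ab assoc_mult_mat)
    finally have block: "subblock m n T {t} {s} = Xq e t q * Yp e s p" .
    \<comment> \<open>Uniqueness of the first exit makes the choices in \<open>X\<close> and \<open>Y\<close> agree with \<open>p\<close> and \<open>q\<close>
      and annihilates the summands for all other border arcs.\<close>
    have "(SOME p. exit_path G A s e p) = p" "(SOME q. onward_path G t e q) = q"
      using unique e p q by (blast intro: some_equality)+
    then have XY: "X e t = Xq e t q" "Y e s = Yp e s p"
      using p q by (auto simp: X_def Y_def)
    have zero: "(\<Sum>l<\<rho> e'. X e' t $$ (r, l) * Y e' s $$ (l, c)) = 0"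
      if "e' \<in> border_arcs G A" "e' \<noteq> e" for e'
    proof -
      have "(\<nexists>p. exit_path G A s e' p) \<or> (\<nexists>q. onward_path G t e' q)"
        using unique that by blast
      then show ?thesis using rc by (auto simp: X_def Y_def intro!: sum.neutral)
    qed
    have "finite (border_arcs G A)"
      by (rule finite_subset[OF _ pair_finite_arcs]) (auto simp: border_arcs_def)
    then have "(\<Sum>e\<in>border_arcs G A. \<Sum>l<\<rho> e. X e t $$ (r, l) * Y e s $$ (l, c)) =
      (\<Sum>l<\<rho> e. Xq e t q $$ (r, l) * Yp e s p $$ (l, c))"
      using e zero by (simp add: sum.remove XY)
    also have "\<dots> = (Xq e t q * Yp e s p) $$ (r, c)"
      using Xq Yp rc by (simp add: scalar_prod_def lessThan_atLeast0)
    finally show ?thesis by (simp add: block)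
  qed
  then show thesis by (rule that)
qed

section \<open>Entries of blocks\<close>

definition block_offset :: "(nat \<Rightarrow> nat) \<Rightarrow> nat \<Rightarrow> nat" where
  "block_offset d i = (\<Sum>k\<in>{1..<i}. d k)"

text \<open>Blocks are numbered from 1; \<open>block_indices d 0\<close> is empty whatever \<open>d 0\<close> is, so the
  equation may fail for \<open>i = 0\<close>.\<close>

lemma block_indices_eq:
  "1 \<le> i \<Longrightarrow> block_indices d i = {block_offset d i ..< block_offset d i + d i}"
  by (cases i) (auto simp: block_indices_def block_offset_def
      atLeastLessThanSuc_atLeastAtMost[symmetric])

lemma subblock_singleton_entry:
  assumes "1 \<le> i" and "1 \<le> j" and "x \<in> block_indices m i" and "y \<in> block_indices n j"
    and "x < dim_row T" and "y < dim_col T"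
  shows "subblock m n T {i} {j} $$ (x - block_offset m i, y - block_offset n j) = T $$ (x, y)"
proof -
  have "card {a \<in> block_indices d k. a < z} = z - block_offset d k"
    if "1 \<le> k" "z \<in> block_indices d k" for d k z
  proof -
    have "{a \<in> block_indices d k. a < z} = {block_offset d k ..< z}"
      using that by (auto simp: block_indices_eq)
    then show ?thesis by simp
  qed
  then show ?thesis
    using submatrix_index_card[of x T y "block_indices m i" "block_indices n j"] assms
    by (simp add: subblock_def)
qed

text \<open>A row of the submatrix belongs to some block \<open>i \<in> I\<close> and a column to some block \<open>j \<in> J\<close>.
  Reading the entry formula at the positions inside these blocks separates rows from columns in the
  whole submatrix.\<close>

lemma rank_subblock_le:
  fixes T :: "'a::field mat"
  assumes "finite S" and "0 \<notin> I" and "0 \<notin> J"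
    and entries: "\<And>i j r c. i \<in> I \<Longrightarrow> j \<in> J \<Longrightarrow> r < m i \<Longrightarrow> c < n j \<Longrightarrow>
      subblock m n T {i} {j} $$ (r, c) = (\<Sum>x\<in>S. f x i r * g x j c)"
  shows "mat_rank (subblock m n T I J) \<le> card S"
proof -
  let ?I = "\<Union>i\<in>I. block_indices m i" and ?J = "\<Union>j\<in>J. block_indices n j"
  let ?B = "subblock m n T I J"
  define row where "row x = (SOME i. i \<in> I \<and> x \<in> block_indices m i)" for x
  define column where "column y = (SOME j. j \<in> J \<and> y \<in> block_indices n j)" for y
  have row: "row x \<in> I \<and> x \<in> block_indices m (row x)" if "x \<in> ?I" for x
    unfolding row_def by (rule someI_ex) (use that in blast)
  have column: "column y \<in> J \<and> y \<in> block_indices n (column y)" if "y \<in> ?J" for y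
    unfolding column_def by (rule someI_ex) (use that in blast)
  have "?B $$ (u, v) =
      (\<Sum>x\<in>S. f x (row (pick ?I u)) (pick ?I u - block_offset m (row (pick ?I u))) *
             g x (column (pick ?J v)) (pick ?J v - block_offset n (column (pick ?J v))))"
    if "u < dim_row ?B" "v < dim_col ?B" for u v
  proof -
    have uv: "u < card {i. i < dim_row T \<and> i \<in> ?I}" "v < card {j. j < dim_col T \<and> j \<in> ?J}"
      using that by (simp_all add: subblock_def dim_submatrix)
    define x y where "x = pick ?I u" and "y = pick ?J v"
    have xy: "x < dim_row T" "y < dim_col T" "x \<in> ?I" "y \<in> ?J"
      using pick_le[OF uv(1)] pick_le[OF uv(2)]
        pick_in_set_le[OF uv(1)] pick_in_set_le[OF uv(2)]
      unfolding x_def y_def pick_reduce_set[OF uv(1), symmetric] pick_reduce_set[OF uv(2), symmetric]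
      by simp_all
    have pos: "1 \<le> row x" "1 \<le> column y"
      using row[OF xy(3)] column[OF xy(4)] assms(2,3) by (metis One_nat_def Suc_leI gr0I)+
    have "?B $$ (u, v) = T $$ (x, y)"
      using uv by (simp add: subblock_def submatrix_index x_def y_def)
    also have "\<dots> = subblock m n T {row x} {column y}
        $$ (x - block_offset m (row x), y - block_offset n (column y))"
      using subblock_singleton_entry[of "row x" "column y" x m y n T] row[OF xy(3)] column[OF xy(4)] pos xy
      by simp
    also have "\<dots> = (\<Sum>z\<in>S. f z (row x) (x - block_offset m (row x)) *
        g z (column y) (y - block_offset n (column y)))"
      using row[OF xy(3)] column[OF xy(4)] pos
      by (intro entries) (auto simp: block_indices_eq)
    finally show ?thesis by (simp add: x_def y_def)
  qed
  then show ?thesis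
    unfolding mat_rank_def by (intro vec_space.rank_le_card_products[OF assms(1)]) auto
qed

theorem proposition4p2:
  fixes G :: "nat pair_pre_digraph" and K :: nat
    and m n :: "nat \<Rightarrow> nat" and \<rho> :: "nat \<times> nat \<Rightarrow> nat" and T :: "'a::field mat"
  assumes "pverts G = {1..K}"
    and "undirected_tree G"
    and "tqs G m n \<rho> T"
  shows "girs G m n T (real (max_weight G \<rho>))"
proof -
  interpret pair_graph G using assms(2) by (simp add: undirected_tree_def)
  have "mat_rank (subblock m n T (pverts G - A) A) \<le> max_weight G \<rho> * border_edges G A"
    if A: "A \<subseteq> pverts G" for A
  proof -
    obtain X Y :: "nat \<times> nat \<Rightarrow> nat \<Rightarrow> 'a mat" where XY:
      "\<And>s t r c. s \<in> A \<Longrightarrow> t \<in> pverts G - A \<Longrightarrow> r < m t \<Longrightarrow> c < n s \<Longrightarrow>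
         subblock m n T {t} {s} $$ (r, c) =
           (\<Sum>e\<in>border_arcs G A. \<Sum>l<\<rho> e. X e t $$ (r, l) * Y e s $$ (l, c))"
      using tqs_block_factorization[OF assms(2,3) A] by blast
    have border: "border_arcs G A \<subseteq> parcs G" by (auto simp: border_arcs_def)
    then have fin: "finite (border_arcs G A)" using pair_finite_arcs finite_subset by blast
    \<comment> \<open>One rank-one term for each border arc \<open>e\<close> and each of the \<open>\<rho> e\<close> coordinates carried by it.\<close>
    let ?S = "SIGMA e:border_arcs G A. {..<\<rho> e}"
    have "mat_rank (subblock m n T (pverts G - A) A) \<le> card ?S"
    proof (rule rank_subblock_le)
      show "finite ?S" using fin by simp
      show "0 \<notin> pverts G - A" "0 \<notin> A" using assms(1) A by auto
      show "subblock m n T {t} {s} $$ (r, c) =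
          (\<Sum>x\<in>?S. X (fst x) t $$ (r, snd x) * Y (fst x) s $$ (snd x, c))"
        if "t \<in> pverts G - A" "s \<in> A" "r < m t" "c < n s" for t s r c
        using XY[OF that(2,1,3,4)] fin by (simp add: sum.Sigma case_prod_beta)
    qed
    also have "card ?S = (\<Sum>e\<in>border_arcs G A. \<rho> e)" using fin by simp
    also have "\<dots> \<le> (\<Sum>e\<in>border_arcs G A. max_weight G \<rho>)"
      using border pair_finite_arcs by (intro sum_mono) (auto simp: max_weight_def)
    also have "\<dots> = max_weight G \<rho> * border_edges G A"
      by (simp add: border_edges_def border_arcs_def)
    finally show ?thesis .
  qed
  then show ?thesis
    unfolding girs_def by (auto simp flip: of_nat_mult)
qed

end
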